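(* Let $(\mu,\vec\phi)$ be an eigenpair of the $1$-Laplacian of a connected graph $G$. If $\vec\phi$ has $k$ nodal domains $D_1,\dots,D_k$ (positive and negative ones together), then each of $\hat{\vec 1}_{D_1},\dots,\hat{\vec 1}_{D_k}$ is an eigenvector of the $1$-Laplacian of $G$ with the same eigenvalue $\mu$.
   Context: $G=(V,E)$ is a finite simple undirected connected graph, $V=\{1,\dots,n\}$, $n\ge 2$; $d_i$ is the degree of $i$; $j\sim i$ means adjacency; $\mathrm{vol}(A)=\sum_{i\in A}d_i$. $\mathrm{Sgn}(t)=\{1\}$ if $t>0$, $\{-1\}$ if $t<0$, $[-1,1]$ if $t=0$. $(\mu,\vec x)$ with $\mu\in\mathbb R$, $\vec x\in\mathbb R^n\setminus\{0\}$ is an eigenpair of the $1$-Laplacian ($\vec x$ an eigenvector with eigenvalue $\mu$) if there exist numbers $z_{ij}\in\mathrm{Sgn}(x_i-x_j)$ with $z_{ji}=-z_{ij}$ (for all adjacent $i,j$) such that $\sum_{j\sim i}z_{ij}\in\mu d_i\,\mathrm{Sgn}(x_i)$ for all $i\in V$. The nodal domains of $\vec x$ are the vertex sets of the connected components of the subgraph induced on $\{i:x_i>0\}$ (positive) and of the subgraph induced on $\{i:x_i<0\}$ (negative). For nonempty $D\subset V$, $\vec 1_D$ is the indicator vector of $D$ and $\hat{\vec 1}_D=\vec 1_D/\mathrm{vol}(D)$. *)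

theory Defs
  imports "HOL-Analysis.Analysis" "Graph_Theory.Digraph_Component"
begin

text \<open>
  A finite simple undirected graph is a \<^locale>\<open>pair_graph\<close>: a finite, symmetric, loop-free digraph
  without parallel arcs, in which an undirected edge is the pair of opposite arcs. Hence the degree
  of a vertex is its out-degree. The library coerces such a graph silently to a \<^type>\<open>pre_digraph\<close>
  through \<^const>\<open>with_proj\<close>. The vertex set is a finite type, so that vectors indexed by the
  vertices are elements of a Euclidean space.
\<close>

definition vol :: "'n pair_pre_digraph \<Rightarrow> 'n set \<Rightarrow> real" where
  "vol G A = (\<Sum>i\<in>A. real (out_degree G i))"

definition Sgn :: "real \<Rightarrow> real set" where
  "Sgn t = (if t > 0 then {1} else if t < 0 then {-1} else {-1..1})"

definition eigenpair :: "'n::finite pair_pre_digraph \<Rightarrow> real \<Rightarrow> real ^ 'n \<Rightarrow> bool" where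
  "eigenpair G \<mu> x \<longleftrightarrow> x \<noteq> 0 \<and>
     (\<exists>z :: 'n \<Rightarrow> 'n \<Rightarrow> real.
        (\<forall>i j. (i, j) \<in> parcs G \<longrightarrow> z i j \<in> Sgn (x $ i - x $ j) \<and> z j i = - z i j) \<and>
        (\<forall>i. (\<Sum>j | (i, j) \<in> parcs G. z i j) \<in> (\<lambda>s. \<mu> * real (out_degree G i) * s) ` Sgn (x $ i)))"

text \<open>
  A connected component is a maximal connected subgraph. The name \<open>connected\<close> is qualified because
  topological connectedness has the same one. The library's connectedness includes nonemptiness.
\<close>

definition component_verts :: "'n pair_pre_digraph \<Rightarrow> 'n set \<Rightarrow> 'n set set" where
  "component_verts G S =
     verts ` {H. pre_digraph.max_subgraph (induce_subgraph G S) Digraph_Component.connected H}"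

definition nodal_domains :: "'n::finite pair_pre_digraph \<Rightarrow> real ^ 'n \<Rightarrow> 'n set set" where
  "nodal_domains G x = component_verts G {i. x $ i > 0} \<union> component_verts G {i. x $ i < 0}"

definition normalized_indicator :: "'n::finite pair_pre_digraph \<Rightarrow> 'n set \<Rightarrow> real ^ 'n" where
  "normalized_indicator G D = (1 / vol G D) *\<^sub>R (\<chi> i. indicator D i)"

end

theory Submission
  imports Defs
begin

text \<open>
  A flow \<open>z\<close> certifying \<open>\<phi>\<close> also certifies the indicator of a positive nodal domain \<open>D\<close>: an edge
  leaving \<open>D\<close> ends where \<open>\<phi>\<close> is nonpositive, so \<open>z = 1\<close> on it, while \<open>[-1, 1]\<close> contains the value
  of \<open>z\<close> on any other edge. At a vertex outside \<open>D\<close> the eigenvalue condition only becomes weaker.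
  Negative domains are the positive domains of \<open>-\<phi>\<close>.
\<close>

text \<open>The vertex \<open>s\<close> serves as a hub: old vertices are joined to it by
  hypothesis, \<open>t\<close> by the new arc, which the symmetric closure makes usable both ways.
  This is the combinatorial core of growing a connected subgraph by one arc.\<close>

lemma rtrancl_on_symcl_insert_arc:
  assumes "\<And>u v. u \<in> V \<Longrightarrow> v \<in> V \<Longrightarrow> (u, v) \<in> rtrancl_on V (R\<^sup>s)"
    and "s \<in> V" and "u \<in> insert t V" and "v \<in> insert t V"
  shows "(u, v) \<in> rtrancl_on (insert t V) ((insert (s, t) R)\<^sup>s)"
proof -
  let ?V = "insert t V" and ?R = "(insert (s, t) R)\<^sup>s"
  have old: "(a, b) \<in> rtrancl_on ?V ?R" if "a \<in> V" "b \<in> V" for a b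
    by (rule rtrancl_on_mono[OF _ _ assms(1)[OF that]]) (auto simp: symcl_def)
  have "(s, t) \<in> rtrancl_on ?V ?R" "(t, s) \<in> rtrancl_on ?V ?R"
    using assms(2) by (auto simp: symcl_def intro: rtrancl_on_into_rtrancl_on)
  then have "(a, s) \<in> rtrancl_on ?V ?R \<and> (s, a) \<in> rtrancl_on ?V ?R" if "a \<in> ?V" for a
    using that old[of a s] old[of s a] assms(2) by auto
  then show ?thesis
    using assms(3,4) rtrancl_on_trans[of u s ?V ?R v] by simp
qed

text \<open>An arc leaving \<open>H\<close> could be added together with its head, giving a strictly
  larger connected subgraph and contradicting maximality.\<close>

lemma max_connected_subgraph_arc_closed:
  assumes "wf_digraph K"
    and "pre_digraph.max_subgraph K Digraph_Component.connected H"
    and "e \<in> arcs K" and "tail K e \<in> verts H"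
  shows "head K e \<in> verts H"
proof (rule ccontr)
  assume notin: "head K e \<notin> verts H"
  have HK: "subgraph H K" and conn: "Digraph_Component.connected H"
    and max: "\<And>H'. \<lbrakk>H' \<noteq> H; subgraph H H'; subgraph H' K\<rbrakk>
      \<Longrightarrow> \<not> Digraph_Component.connected H'"
    using assms(2) by (auto simp: pre_digraph.max_subgraph_def)
  interpret K: wf_digraph K by fact
  interpret H: wf_digraph H using HK by auto
  \<comment> \<open>The reverse of \<open>e\<close> is not added: connectedness is measured in the
    symmetric closure, so one orientation is enough.\<close>
  define H' where "H' = \<lparr>verts = insert (head K e) (verts H), arcs = insert e (arcs H),
    tail = tail K, head = head K\<rparr>"
  have ends: "tail H = tail K" "head H = head K"
    using HK by (auto simp: subgraph_def compatible_def)
  have wf: "wf_digraph H'"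
    using assms(4) H.wellformed ends by unfold_locales (auto simp: H'_def)
  have "subgraph H' K"
    using HK wf assms(1,3) K.head_in_verts by (auto simp: subgraph_def compatible_def H'_def)
  moreover have "subgraph H H'"
    using wf H.wf_digraph_axioms ends by (auto simp: subgraph_def compatible_def H'_def)
  moreover have "H' \<noteq> H"
    using notin by (metis H'_def insertI1 pre_digraph.select_convs(1))
  moreover have "Digraph_Component.connected H'"
  proof -
    have "arcs_ends H' = insert (tail K e, head K e) (arcs_ends H)"
      by (auto simp: arcs_ends_conv H'_def ends)
    moreover have "verts H' = insert (head K e) (verts H)"
      by (simp add: H'_def)
    moreover have "(u, v) \<in> rtrancl_on (verts H) ((arcs_ends H)\<^sup>s)"
      if "u \<in> verts H" "v \<in> verts H" for u v
      using conn that by (simp add: connected_conv)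
    ultimately show ?thesis
      using rtrancl_on_symcl_insert_arc[OF _ assms(4)] by (simp add: connected_conv)
  qed
  ultimately show False
    using max by blast
qed

lemma component_verts_properties:
  assumes "pair_graph G" and "D \<in> component_verts G S"
  shows "D \<noteq> {}" and "D \<subseteq> S"
    and "\<And>i j. \<lbrakk>(i, j) \<in> parcs G; i \<in> D; j \<in> S\<rbrakk> \<Longrightarrow> j \<in> D"
proof -
  interpret pair_graph G by fact
  obtain H where H: "D = verts H"
      "pre_digraph.max_subgraph (induce_subgraph G S) Digraph_Component.connected H"
    using assms(2) by (auto simp: component_verts_def)
  then show "D \<noteq> {}" and DS: "D \<subseteq> S"
    by (auto simp: pre_digraph.max_subgraph_def connected_conv subgraph_def)
  \<comment> \<open>Since \<open>D\<close> lies in \<open>S\<close>, both ends of the arc do, so it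
    survives in the induced subgraph, where maximality applies.\<close>
  show "j \<in> D" if "(i, j) \<in> parcs G" "i \<in> D" "j \<in> S" for i j
    using max_connected_subgraph_arc_closed[OF wellformed_induce_subgraph H(2), of "(i, j)"]
      that H(1) DS by auto
qed

text \<open>A path from \<open>i\<close> to a second vertex must begin with an edge at
  \<open>i\<close>. This makes volumes of nonempty sets positive, so that normalizing an indicator
  is scaling by a positive factor.\<close>

lemma out_degree_pos:
  fixes G :: "'n::finite pair_pre_digraph"
  assumes "pair_graph G" and "pverts G = UNIV" and "CARD('n) \<ge> 2"
    and "Digraph_Component.connected G"
  shows "out_degree G i > 0"
proof -
  interpret pair_graph G by fact
  have "\<not> UNIV \<subseteq> {i}"
    using assms(3) card_mono[of "{i}" UNIV] by auto
  then obtain j where "j \<noteq> i" by auto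
  have "(i, j) \<in> ((arcs_ends G)\<^sup>s)\<^sup>*"
    using assms(2,4) by (auto simp: connected_conv intro: rtrancl_on_rtranclI[of _ _ UNIV])
  then obtain k where "(i, k) \<in> (arcs_ends G)\<^sup>s"
    using \<open>j \<noteq> i\<close> by (auto elim: converse_rtranclE)
  then have "(i, k) \<in> parcs G"
    using arcs_symmetric by (auto simp: symcl_def)
  then have "out_arcs G i \<noteq> {}"
    by (auto simp: out_arcs_def)
  then show ?thesis
    by (simp add: out_degree_def card_gt_0_iff)
qed

lemma Sgn_uminus: "s \<in> Sgn (- t) \<longleftrightarrow> - s \<in> Sgn t"
  by (auto simp: Sgn_def)

lemma Sgn_bounds: "s \<in> Sgn t \<Longrightarrow> s \<in> {-1..1}"
  by (auto simp: Sgn_def split: if_splits)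

text \<open>Both conditions survive negating the flow together with the vector, because
  \<open>Sgn\<close> is odd.\<close>

lemma eigenpair_uminus:
  assumes "eigenpair G \<mu> x"
  shows "eigenpair G \<mu> (- x)"
proof -
  obtain z where x: "x \<noteq> 0"
    and z: "\<And>i j. (i, j) \<in> parcs G \<Longrightarrow> z i j \<in> Sgn (x $ i - x $ j) \<and> z j i = - z i j"
    and s: "\<And>i. (\<Sum>j | (i, j) \<in> parcs G. z i j)
      \<in> (\<lambda>s. \<mu> * real (out_degree G i) * s) ` Sgn (x $ i)"
    using assms unfolding eigenpair_def by blast
  have "- z i j \<in> Sgn ((- x) $ i - (- x) $ j) \<and> - z j i = - (- z i j)"
    if "(i, j) \<in> parcs G" for i j
    using z[OF that] Sgn_uminus[of "- z i j" "x $ i - x $ j"] by simp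
  moreover have "(\<Sum>j | (i, j) \<in> parcs G. - z i j)
      \<in> (\<lambda>s. \<mu> * real (out_degree G i) * s) ` Sgn ((- x) $ i)" for i
  proof -
    obtain t where "t \<in> Sgn (x $ i)" "(\<Sum>j | (i, j) \<in> parcs G. z i j) = \<mu> * real (out_degree G i) * t"
      using s[of i] by blast
    then show ?thesis
      by (intro image_eqI[of _ _ "- t"]) (simp_all add: sum_negf Sgn_uminus)
  qed
  ultimately show ?thesis
    using x unfolding eigenpair_def by (intro conjI exI[of _ "\<lambda>i j. - z i j"]) auto
qed

text \<open>\<open>Sgn\<close> sees only signs, so the size of \<open>c\<close> is immaterial. The
  assumption \<open>closed\<close> says that no edge joins \<open>D\<close> to the rest of the
  positive set.\<close>

lemma eigenpair_scaled_indicator: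
  assumes "eigenpair G \<mu> x" and "c > 0" and "D \<noteq> {}" and "D \<subseteq> {i. x $ i > 0}"
    and sym: "\<And>i j. (i, j) \<in> parcs G \<Longrightarrow> (j, i) \<in> parcs G"
    and closed: "\<And>i j. \<lbrakk>(i, j) \<in> parcs G; i \<in> D; x $ j > 0\<rbrakk> \<Longrightarrow> j \<in> D"
  shows "eigenpair G \<mu> (c *\<^sub>R (\<chi> i. indicator D i))"
proof -
  let ?y = "c *\<^sub>R (\<chi> i. indicator D i) :: real ^ _"
  obtain z where z: "\<And>i j. (i, j) \<in> parcs G \<Longrightarrow> z i j \<in> Sgn (x $ i - x $ j) \<and> z j i = - z i j"
    and s: "\<And>i. (\<Sum>j | (i, j) \<in> parcs G. z i j)
      \<in> (\<lambda>s. \<mu> * real (out_degree G i) * s) ` Sgn (x $ i)"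
    using assms(1) unfolding eigenpair_def by blast
  have boundary: "z i j = 1" if "(i, j) \<in> parcs G" "i \<in> D" "j \<notin> D" for i j
  proof -
    have "x $ j \<le> 0" "x $ i > 0"
      using closed[OF that(1,2)] that assms(4) by (force simp: not_less)+
    then show ?thesis
      using z[OF that(1)] by (simp add: Sgn_def)
  qed
  have "z i j \<in> Sgn (?y $ i - ?y $ j)" if ij: "(i, j) \<in> parcs G" for i j
  proof (cases "i \<in> D \<longleftrightarrow> j \<in> D")
    case True
    then have "Sgn (?y $ i - ?y $ j) = {-1..1}" by (simp add: Sgn_def indicator_def)
    then show ?thesis
      using Sgn_bounds z[OF ij] by blast
  next
    case False
    \<comment> \<open>If \<open>i\<close> is the end outside \<open>D\<close>,
      \<open>boundary\<close> applies to the reversed edge and antisymmetry gives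
      \<open>z i j = -1\<close>.\<close>
    then show ?thesis
      using boundary[OF ij] boundary[OF sym[OF ij]] z[OF ij] assms(2)
      by (cases "i \<in> D") (simp_all add: Sgn_def)
  qed
  moreover have "(\<Sum>j | (i, j) \<in> parcs G. z i j)
      \<in> (\<lambda>s. \<mu> * real (out_degree G i) * s) ` Sgn (?y $ i)" for i
  proof -
    \<comment> \<open>On \<open>D\<close> both sets are \<open>{1}\<close>; elsewhere the indicator
      vanishes and the right side is all of \<open>{-1..1}\<close>.\<close>
    have "Sgn (x $ i) \<subseteq> Sgn (?y $ i)"
      using assms(2,4) by (auto simp: Sgn_def indicator_def)
    then show ?thesis
      using s[of i] by blast
  qed
  moreover have "?y \<noteq> 0"
    using assms(2,3) by (auto simp: vec_eq_iff indicator_def)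
  ultimately show ?thesis
    using z unfolding eigenpair_def by (intro conjI exI[of _ z]) simp_all
qed

theorem corollary1:
  fixes G :: "'n::finite pair_pre_digraph"
    and \<mu> :: real and \<phi> :: "real ^ 'n"
    and k :: nat and D :: "nat \<Rightarrow> 'n set"
  assumes "pair_graph G"
    and "pverts G = UNIV"
    and "CARD('n) \<ge> 2"
    and "Digraph_Component.connected G"
    and "eigenpair G \<mu> \<phi>"
    and "bij_betw D {1..k} (nodal_domains G \<phi>)"
  shows "\<forall>i\<in>{1..k}. eigenpair G \<mu> (normalized_indicator G (D i))"
proof -
  interpret pair_graph G by fact
  \<comment> \<open>The eigenvector is left arbitrary so that the claim can be used for both \<phi>
    and its negative.\<close>
  have positive: "eigenpair G \<mu> (normalized_indicator G A)"
    if x: "eigenpair G \<mu> x" and A: "A \<in> component_verts G {i. x $ i > 0}" for x A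
  proof -
    note props = component_verts_properties[OF assms(1) A]
    have "vol G A > 0"
      unfolding vol_def using props(1) out_degree_pos[OF assms(1-4)] by (intro sum_pos) auto
    then show ?thesis
      unfolding normalized_indicator_def using props arcs_symmetric
      by (intro eigenpair_scaled_indicator[OF x]) auto
  qed
  have "eigenpair G \<mu> (normalized_indicator G A)" if "A \<in> nodal_domains G \<phi>" for A
    using that positive[OF assms(5), of A] positive[OF eigenpair_uminus[OF assms(5)], of A]
    by (auto simp: nodal_domains_def)
  then show ?thesis
    using assms(6) by (auto simp: bij_betw_def)
qed

end
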